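(* Let $q$ be a positive integer and let $\Pi$ be a finite projective plane of order $q$, i.e. a $(q^2+q+1,\,q+1,\,1)$-design. Then $\gamma(\Pi)=2q$.
   Context: Let $X$ be a finite set of $v$ points. A $(v,k,\lambda)$-design over $X$ is a finite multiset $D$ of $k$-element subsets of $X$ (called blocks) such that every two distinct points of $X$ are contained together in exactly $\lambda$ blocks, counted with multiplicity; throughout $2\le k\le v$ and $\lambda\ge 1$. The incidence graph $G_D$ is the bipartite graph whose vertex set is the disjoint union of the points and the blocks of $D$, a point $x$ being adjacent to a block $B$ if and only if $x\in B$. A set $S$ of vertices of a graph is dominating if every vertex not in $S$ has a neighbour in $S$; the domination number $\gamma(G)$ of a graph $G$ is the minimum cardinality of a dominating set of $G$, and $\gamma(D):=\gamma(G_D)$. *)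

theory Defs
  imports "HOL-Library.Multiset" "Graph_Theory.Graph_Theory"
begin

locale design =
  fixes X :: "'a set" and D :: "'a set multiset" and v k l :: nat
  assumes finite_points: "finite X"
    and card_points: "card X = v"
    and two_le_k: "2 \<le> k"
    and k_le_v: "k \<le> v"
    and l_pos: "1 \<le> l"
    and block_subset: "B \<in># D \<Longrightarrow> B \<subseteq> X"
    and block_card: "B \<in># D \<Longrightarrow> card B = k"
    and balanced: "x \<in> X \<Longrightarrow> y \<in> X \<Longrightarrow> x \<noteq> y \<Longrightarrow> size {# B \<in># D. x \<in> B \<and> y \<in> B #} = l"

definition projective_plane :: "'a set \<Rightarrow> 'a set multiset \<Rightarrow> nat \<Rightarrow> bool" where
  "projective_plane X D q \<longleftrightarrow> design X D (q^2 + q + 1) (q + 1) 1"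

(* Blocks with multiplicity m contribute m distinct vertices:
   the i-th copy of a block B is the vertex Inr (B, i), i < count D B. *)
definition block_copies :: "'a set multiset \<Rightarrow> ('a set \<times> nat) set" where
  "block_copies D = {(B, i). i < count D B}"

(* Undirected graphs are symmetric digraphs, as in Graph_Theory (locale pair_graph);
   see pair_graph_incidence_graph below. *)
definition incidence_graph ::
    "'a set \<Rightarrow> 'a set multiset \<Rightarrow> ('a + ('a set \<times> nat)) pair_pre_digraph" where
  "incidence_graph X D =
    \<lparr> pverts = X <+> block_copies D,
      parcs = {(Inl x, Inr (B, i)) | x B i. x \<in> X \<and> (B, i) \<in> block_copies D \<and> x \<in> B}
            \<union> {(Inr (B, i), Inl x) | x B i. x \<in> X \<and> (B, i) \<in> block_copies D \<and> x \<in> B} \<rparr>"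

definition dominating_set :: "'b pair_pre_digraph \<Rightarrow> 'b set \<Rightarrow> bool" where
  "dominating_set G S \<longleftrightarrow>
    S \<subseteq> pverts G \<and> (\<forall>u \<in> pverts G - S. \<exists>w \<in> S. (u, w) \<in> parcs G)"

(* For a finite graph the minimum exists, since the set of all vertices is dominating. *)
definition domination_number :: "'b pair_pre_digraph \<Rightarrow> nat" where
  "domination_number G = (LEAST n. \<exists>S. dominating_set G S \<and> finite S \<and> card S = n)"

definition design_domination_number :: "'a set \<Rightarrow> 'a set multiset \<Rightarrow> nat" where
  "design_domination_number X D = domination_number (incidence_graph X D)"

lemma finite_block_copies: "finite (block_copies D)"
proof -
  have "block_copies D = (SIGMA B:set_mset D. {..<count D B})"
    unfolding block_copies_def by (auto simp flip: count_greater_zero_iff)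
  then show ?thesis by simp
qed

lemma pair_graph_incidence_graph:
  assumes "finite X"
  shows "pair_graph (incidence_graph X D)"
proof -
  let ?G = "incidence_graph X D"
  have fin: "finite (pverts ?G)"
    using assms by (simp add: incidence_graph_def finite_block_copies)
  have sub: "parcs ?G \<subseteq> pverts ?G \<times> pverts ?G"
    by (auto simp: incidence_graph_def)
  have "finite (parcs ?G)"
    using finite_subset[OF sub] fin by blast
  moreover have "symmetric (with_proj ?G)"
    by (auto simp: symmetric_def incidence_graph_def intro!: symI)
  moreover have "fst e \<noteq> snd e" if "e \<in> parcs ?G" for e
    using that by (auto simp: incidence_graph_def)
  ultimately show ?thesis
    using fin sub by unfold_locales auto
qed

end

theory Submission
  imports Defs
begin

text \<open>
  Let \<open>P\<close> be a set of \<open>a\<close> points and \<open>C\<close> a set of \<open>b\<close> lines that together dominate the incidence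
  graph. Every line passes through \<open>q + 1\<close> points and every point lies on \<open>q + 1\<close> lines, so each
  vertex of the set dominates at most \<open>q + 1\<close> vertices of the other kind. As there are
  \<open>q\<^sup>2 + q + 1\<close> points and just as many lines, this gives
  \<open>a + (q + 1) b \<ge> q\<^sup>2 + q + 1\<close> and \<open>b + (q + 1) a \<ge> q\<^sup>2 + q + 1\<close>.
  If \<open>a < q\<close>, the second inequality yields \<open>a + b \<ge> q\<^sup>2 + q + 1 - q a > 2 q\<close>; the case
  \<open>b < q\<close> is symmetric, and otherwise \<open>a + b \<ge> 2 q\<close> at once.
  The counts of lines, in all and through a point, come from the design axioms by double counting
  (\<open>card_pencil\<close>, \<open>card_L\<close>).

  The bound is attained by a flag, that is, a point \<open>p\<close> on a line \<open>m\<close>: take the \<open>q\<close> points of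
  \<open>m\<close> other than \<open>p\<close> and the \<open>q\<close> lines through \<open>p\<close> other than \<open>m\<close>. A point off \<open>m\<close> is joined to
  \<open>p\<close> by one of these lines, a line avoiding \<open>p\<close> meets \<open>m\<close> in one of these points (\<open>lines_meet\<close>), and \<open>p\<close> and
  \<open>m\<close> are themselves dominated because \<open>q > 0\<close>.
\<close>

section \<open>Projective planes as incidence structures\<close>

text \<open>
  Lines are abstract objects with a set of points each, so that the copies of a block in a
  multiset can serve as lines directly.
\<close>

locale finite_projective_plane =
  fixes X :: "'a set" and L :: "'c set" and pts :: "'c \<Rightarrow> 'a set" and q :: nat
  assumes q_pos: "q > 0"
    and finite_X: "finite X"
    and finite_L: "finite L"
    and card_X: "card X = q^2 + q + 1"
    and pts_subset: "c \<in> L \<Longrightarrow> pts c \<subseteq> X"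
    and card_pts: "c \<in> L \<Longrightarrow> card (pts c) = q + 1"
    and card_joining: "x \<in> X \<Longrightarrow> y \<in> X \<Longrightarrow> x \<noteq> y \<Longrightarrow> card {c \<in> L. x \<in> pts c \<and> y \<in> pts c} = 1"
begin

definition pencil :: "'a \<Rightarrow> 'c set" where
  "pencil x = {c \<in> L. x \<in> pts c}"

lemma finite_pencil: "finite (pencil x)"
  using finite_L by (simp add: pencil_def)

lemma finite_pts: "c \<in> L \<Longrightarrow> finite (pts c)"
  using pts_subset finite_X finite_subset by blast

lemma joining_line_exists:
  assumes "x \<in> X" "y \<in> X" "x \<noteq> y"
  shows "\<exists>c \<in> L. x \<in> pts c \<and> y \<in> pts c"
proof -
  have "{c \<in> L. x \<in> pts c \<and> y \<in> pts c} \<noteq> {}"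
    using card_joining[OF assms] by (metis card.empty zero_neq_one)
  then show ?thesis by blast
qed

lemma joining_line_unique:
  assumes "x \<noteq> y" "c \<in> L" "x \<in> pts c" "y \<in> pts c" "d \<in> L" "x \<in> pts d" "y \<in> pts d"
  shows "c = d"
proof -
  have "card {c \<in> L. x \<in> pts c \<and> y \<in> pts c} = 1"
    using assms pts_subset by (intro card_joining) auto
  then obtain e where e: "{c \<in> L. x \<in> pts c \<and> y \<in> pts c} = {e}"
    by (rule card_1_singletonE)
  have "c \<in> {e}" "d \<in> {e}"
    unfolding e[symmetric] using assms by simp_all
  then show ?thesis by simp
qed

text \<open>
  The lines through \<open>x\<close> partition the other \<open>q (q + 1)\<close> points into classes of size \<open>q\<close>.
\<close>

lemma card_pencil:
  assumes "x \<in> X"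
  shows "card (pencil x) = q + 1"
proof -
  have "(\<Sum>c\<in>pencil x. card {y \<in> X - {x}. y \<in> pts c}) = 1 * card (X - {x})"
  proof (rule sum_multicount)
    show "\<forall>y\<in>X - {x}. card {c \<in> pencil x. y \<in> pts c} = 1"
      using card_joining[OF assms] by (auto simp: pencil_def conj_assoc)
  qed (use finite_X finite_pencil in auto)
  moreover have "card {y \<in> X - {x}. y \<in> pts c} = q" if "c \<in> pencil x" for c
  proof -
    have "{y \<in> X - {x}. y \<in> pts c} = pts c - {x}"
      using that pts_subset by (auto simp: pencil_def)
    then show ?thesis using that card_pts by (simp add: pencil_def)
  qed
  ultimately have "card (pencil x) * q = q^2 + q"
    using assms card_X finite_X by simp
  then have "card (pencil x) * q = (q + 1) * q"
    by (simp add: power2_eq_square)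
  then show ?thesis using q_pos by (metis mult_cancel2 less_irrefl)
qed

text \<open>
  There are \<open>q + 1\<close> flags for each line and, by the previous lemma, \<open>q + 1\<close> flags for each point,
  so lines and points are equally numerous.
\<close>

lemma card_L: "card L = q^2 + q + 1"
proof -
  have "(\<Sum>c\<in>L. card {x \<in> X. x \<in> pts c}) = (q + 1) * card X"
  proof (rule sum_multicount)
    show "\<forall>x\<in>X. card {c \<in> L. x \<in> pts c} = q + 1"
      using card_pencil by (simp add: pencil_def)
  qed (use finite_X finite_L in auto)
  moreover have "card {x \<in> X. x \<in> pts c} = q + 1" if "c \<in> L" for c
  proof -
    have "{x \<in> X. x \<in> pts c} = pts c" using pts_subset[OF that] by auto
    then show ?thesis using card_pts[OF that] by simp
  qed
  ultimately have "card L * (q + 1) = card X * (q + 1)"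
    by (simp add: mult.commute)
  then have "card L = card X" by (metis mult_cancel2 Suc_eq_plus1 nat.distinct(1))
  then show ?thesis using card_X by simp
qed

text \<open>
  Joining a point \<open>x\<close> of \<open>c\<close> off \<open>d\<close> to the \<open>q + 1\<close> points of \<open>d\<close> produces \<open>q + 1\<close> different
  lines, which are all the lines through \<open>x\<close>; so \<open>c\<close> is one of them.
\<close>

lemma lines_meet:
  assumes "c \<in> L" "d \<in> L"
  shows "pts c \<inter> pts d \<noteq> {}"
proof -
  obtain x where x: "x \<in> pts c"
    using card_pts[OF assms(1)] by (metis Suc_eq_plus1 card.empty equals0I nat.distinct(1))
  then have xX: "x \<in> X" using assms pts_subset by blast
  show ?thesis
  proof (cases "x \<in> pts d")
    case True
    then show ?thesis using x by blast
  next
    case False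
    have "\<exists>e \<in> L. x \<in> pts e \<and> y \<in> pts e" if "y \<in> pts d" for y
      using that False xX assms(2) pts_subset by (intro joining_line_exists) auto
    then obtain join where join:
      "\<And>y. y \<in> pts d \<Longrightarrow> join y \<in> L \<and> x \<in> pts (join y) \<and> y \<in> pts (join y)"
      by metis
    have "inj_on join (pts d)"
    proof (rule inj_onI, rule ccontr)
      fix y z assume yz: "y \<in> pts d" "z \<in> pts d" "join y = join z" "y \<noteq> z"
      then have "join y = d"
        using join[of y] join[of z] assms(2) by (intro joining_line_unique[of y z]) auto
      then show False using join[OF yz(1)] False by simp
    qed
    then have "card (join ` pts d) = card (pencil x)"
      using card_pts[OF assms(2)] card_pencil[OF xX] by (simp add: card_image)
    moreover have "join ` pts d \<subseteq> pencil x"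
      using join by (auto simp: pencil_def)
    ultimately have "join ` pts d = pencil x"
      using card_subset_eq[OF finite_pencil] by blast
    then have "c \<in> join ` pts d"
      using x assms(1) by (simp add: pencil_def)
    then show ?thesis using join by blast
  qed
qed

section \<open>Dominating pairs of points and lines\<close>

definition dominating :: "'a set \<Rightarrow> 'c set \<Rightarrow> bool" where
  "dominating P C \<longleftrightarrow> P \<subseteq> X \<and> C \<subseteq> L \<and>
    (\<forall>x \<in> X - P. \<exists>c \<in> C. x \<in> pts c) \<and> (\<forall>c \<in> L - C. \<exists>x \<in> P. x \<in> pts c)"

lemma dominating_lower_bound:
  assumes "dominating P C"
  shows "2 * q \<le> card P + card C"
proof -
  have PC: "P \<subseteq> X" "C \<subseteq> L"
    and cover: "X \<subseteq> P \<union> (\<Union>c\<in>C. pts c)" "L \<subseteq> C \<union> (\<Union>x\<in>P. pencil x)"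
    using assms by (auto simp: dominating_def pencil_def)
  have fin: "finite P" "finite C"
    using PC finite_X finite_L finite_subset by auto
  have "card X \<le> card (P \<union> (\<Union>c\<in>C. pts c))"
    using cover fin PC finite_pts by (intro card_mono) auto
  also have "\<dots> \<le> card P + card (\<Union>c\<in>C. pts c)"
    by (rule card_Un_le)
  also have "card (\<Union>c\<in>C. pts c) \<le> (\<Sum>c\<in>C. card (pts c))"
    by (rule card_UN_le[OF fin(2)])
  also have "\<dots> = card C * (q + 1)"
    using PC card_pts by (simp add: subset_iff)
  finally have points: "q^2 + q + 1 \<le> card P + card C * (q + 1)"
    using card_X by simp
  have "card L \<le> card (C \<union> (\<Union>x\<in>P. pencil x))"
    using cover fin finite_pencil by (intro card_mono) auto
  also have "\<dots> \<le> card C + card (\<Union>x\<in>P. pencil x)"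
    by (rule card_Un_le)
  also have "card (\<Union>x\<in>P. pencil x) \<le> (\<Sum>x\<in>P. card (pencil x))"
    by (rule card_UN_le[OF fin(1)])
  also have "\<dots> = card P * (q + 1)"
    using PC card_pencil by (simp add: subset_iff)
  finally have lines: "q^2 + q + 1 \<le> card C + card P * (q + 1)"
    using card_L by simp
  have few: "2 * q \<le> a + b" if "a < q" "q^2 + q + 1 \<le> b + a * (q + 1)" for a b :: nat
  proof -
    have "(a + 1) * q \<le> q * q" using that(1) by (intro mult_right_mono) auto
    then show ?thesis using that(2) by (simp add: power2_eq_square algebra_simps)
  qed
  show ?thesis
    using few[OF _ lines] few[OF _ points] by linarith
qed

lemma dominating_flag:
  assumes m: "m \<in> L" and p: "p \<in> pts m"
  shows "dominating (pts m - {p}) (pencil p - {m})"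
  unfolding dominating_def
proof (intro conjI ballI)
  have pX: "p \<in> X" using assms pts_subset by blast
  show "pts m - {p} \<subseteq> X" using pts_subset[OF m] by blast
  show "pencil p - {m} \<subseteq> L" by (auto simp: pencil_def)
  show "\<exists>c\<in>pencil p - {m}. x \<in> pts c" if x: "x \<in> X - (pts m - {p})" for x
  proof (cases "x = p")
    case True
    have "card (pencil p - {m}) = q"
      using m p card_pencil[OF pX] by (simp add: pencil_def)
    then have "pencil p - {m} \<noteq> {}" using q_pos by (metis card.empty less_irrefl)
    then show ?thesis using True by (auto simp: pencil_def)
  next
    case False
    then obtain c where "c \<in> L" "x \<in> pts c" "p \<in> pts c"
      using joining_line_exists[of x p] x pX by auto
    then show ?thesis using x False by (auto simp: pencil_def)
  qed
  show "\<exists>x\<in>pts m - {p}. x \<in> pts c" if c: "c \<in> L - (pencil p - {m})" for c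
  proof (cases "c = m")
    case True
    have "card (pts m - {p}) = q" using card_pts[OF m] p by simp
    then have "pts m - {p} \<noteq> {}" using q_pos by (metis card.empty less_irrefl)
    then show ?thesis using True by auto
  next
    case False
    then have "p \<notin> pts c" using c by (auto simp: pencil_def)
    then show ?thesis using lines_meet[of c m] c m by auto
  qed
qed

lemma small_dominating_exists: "\<exists>P C. dominating P C \<and> card P + card C = 2 * q"
proof -
  have "L \<noteq> {}" using card_L by auto
  then obtain m where m: "m \<in> L" by blast
  then obtain p where p: "p \<in> pts m"
    using card_pts by (metis Suc_eq_plus1 card.empty equals0I nat.distinct(1))
  then have "p \<in> X" using m pts_subset by blast
  then have "card (pts m - {p}) = q" "card (pencil p - {m}) = q"
    using m p card_pts[OF m] card_pencil by (auto simp: pencil_def)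
  then show ?thesis using dominating_flag[OF m p] by (intro exI conjI) auto
qed

end

section \<open>From designs to incidence structures\<close>

lemma block_copies_eq_Sigma: "block_copies D = (SIGMA B:set_mset D. {..<count D B})"
  unfolding block_copies_def by (auto simp flip: count_greater_zero_iff)

lemma card_block_copies_filter:
  "card {c \<in> block_copies D. Q (fst c)} = size {# B \<in># D. Q B #}"
proof -
  have "{c \<in> block_copies D. Q (fst c)} = (SIGMA B:set_mset (filter_mset Q D). {..<count D B})"
    by (auto simp: block_copies_eq_Sigma)
  then have "card {c \<in> block_copies D. Q (fst c)} = (\<Sum>B\<in>set_mset (filter_mset Q D). count D B)"
    by (simp add: card_SigmaI)
  also have "\<dots> = size (filter_mset Q D)"
    unfolding size_multiset_overloaded_eq by (intro sum.cong) auto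
  finally show ?thesis .
qed

text \<open>
  The lines are the block copies, and \<open>fst\<close> forgets the index of a copy; by
  \<open>card_block_copies_filter\<close>, counting copies is counting blocks with multiplicity.
\<close>

lemma projective_plane_block_copies:
  assumes "q > 0" "projective_plane X D q"
  shows "finite_projective_plane X (block_copies D) fst q"
proof -
  interpret design X D "q^2 + q + 1" "q + 1" 1
    using assms(2) by (simp add: projective_plane_def)
  have mem: "fst c \<in># D" if "c \<in> block_copies D" for c
    using that by (auto simp: block_copies_eq_Sigma)
  show ?thesis
  proof
    show "card {c \<in> block_copies D. x \<in> fst c \<and> y \<in> fst c} = 1"
      if "x \<in> X" "y \<in> X" "x \<noteq> y" for x y
      using balanced[OF that] card_block_copies_filter[of D "\<lambda>B. x \<in> B \<and> y \<in> B"] by simp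
  qed (use assms(1) finite_points card_points finite_block_copies block_subset[OF mem]
      block_card[OF mem] in auto)
qed

lemma dominating_set_incidence_graph_iff:
  assumes "finite_projective_plane X (block_copies D) fst q"
  shows "dominating_set (incidence_graph X D) (P <+> C) \<longleftrightarrow>
    finite_projective_plane.dominating X (block_copies D) fst P C"
proof -
  let ?B = "block_copies D" and ?A = "parcs (incidence_graph X D)"
  have verts: "pverts (incidence_graph X D) = X <+> ?B"
    by (simp add: incidence_graph_def)
  have arcs: "(Inl x, Inl y) \<notin> ?A" "(Inr c, Inr d) \<notin> ?A"
    "(Inl x, Inr c) \<in> ?A \<longleftrightarrow> x \<in> X \<and> c \<in> ?B \<and> x \<in> fst c"
    "(Inr c, Inl x) \<in> ?A \<longleftrightarrow> x \<in> X \<and> c \<in> ?B \<and> x \<in> fst c" for x y c d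
    by (cases c; simp add: incidence_graph_def)+
  have subset: "P <+> C \<subseteq> X <+> ?B \<longleftrightarrow> P \<subseteq> X \<and> C \<subseteq> ?B"
    by auto
  have ball: "(\<forall>u \<in> (X <+> ?B) - (P <+> C). Q u) \<longleftrightarrow>
      (\<forall>x \<in> X - P. Q (Inl x)) \<and> (\<forall>c \<in> ?B - C. Q (Inr c))" for Q
    by auto
  have bex: "(\<exists>w \<in> P <+> C. Q w) \<longleftrightarrow> (\<exists>x \<in> P. Q (Inl x)) \<or> (\<exists>c \<in> C. Q (Inr c))" for Q
    by auto
  have point: "(\<exists>w \<in> P <+> C. (Inl x, w) \<in> ?A) \<longleftrightarrow> (\<exists>c \<in> C. x \<in> fst c)"
    if "C \<subseteq> ?B" "x \<in> X" for x
    unfolding bex using that arcs(1,3) by blast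
  have line: "(\<exists>w \<in> P <+> C. (Inr c, w) \<in> ?A) \<longleftrightarrow> (\<exists>x \<in> P. x \<in> fst c)"
    if "P \<subseteq> X" "c \<in> ?B" for c
    unfolding bex using that arcs(2,4) by blast
  show ?thesis
    unfolding dominating_set_def finite_projective_plane.dominating_def[OF assms]
      verts subset ball conj_assoc
    by (intro conj_cong refl ball_cong point line) simp_all
qed

theorem theorem5p2:
  fixes X :: "'a set" and D :: "'a set multiset" and q :: nat
  assumes "q > 0"
    and "projective_plane X D q"
  shows "design_domination_number X D = 2 * q"
proof -
  interpret finite_projective_plane X "block_copies D" fst q
    using projective_plane_block_copies[OF assms] .
  note dom_iff = dominating_set_incidence_graph_iff[OF projective_plane_block_copies[OF assms]]
  show ?thesis
    unfolding design_domination_number_def domination_number_def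
  proof (rule Least_equality)
    obtain P C where PC: "dominating P C" "card P + card C = 2 * q"
      using small_dominating_exists by blast
    then have "finite P" "finite C"
      using finite_X finite_L finite_subset by (auto simp: dominating_def)
    then have "finite (P <+> C)" "card (P <+> C) = 2 * q"
      using PC by (simp_all add: card_Plus)
    then show "\<exists>S. dominating_set (incidence_graph X D) S \<and> finite S \<and> card S = 2 * q"
      using PC dom_iff by blast
  next
    fix n assume "\<exists>S. dominating_set (incidence_graph X D) S \<and> finite S \<and> card S = n"
    then obtain S where S: "dominating_set (incidence_graph X D) S" "finite S" "card S = n"
      by blast
    define P C where "P = Inl -` S" and "C = Inr -` S"
    have split: "S = P <+> C"
    proof (rule set_eqI)
      show "s \<in> S \<longleftrightarrow> s \<in> P <+> C" for s
        by (cases s) (auto simp: P_def C_def)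
    qed
    have "finite P" "finite C"
      using S(2) unfolding split by (simp_all add: finite_Plus_iff)
    then have "n = card P + card C"
      using S(3) by (simp add: split card_Plus)
    then show "2 * q \<le> n"
      using S(1) dominating_lower_bound dom_iff by (simp add: split)
  qed
qed

end
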